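(* Let $G$ be a simple graph with $n$ vertices and $m$ edges such that $n\leq m\leq \frac{\sqrt{3}-1}{4}(n-1)n$. Then for every natural number $k$ in the interval $\left[\sqrt[3]{\frac{8m^{2}}{n-1}+4mn+n^{2}},\; n\right]$ one has $$S_{k}(G)\leq m+\binom{k+1}{2}.$$
   Context: For a simple graph $G$ on $n$ vertices, the Laplacian matrix is the $n\times n$ matrix $L(G)=D(G)-A(G)$, where $D(G)$ is the diagonal matrix of vertex degrees and $A(G)$ is the adjacency matrix. Its eigenvalues, listed with multiplicity in decreasing order, are the nonnegative reals $\mu_{1}(G)\geq \mu_{2}(G)\geq\cdots\geq\mu_{n}(G)=0$. For $1\leq k\leq n$, $S_{k}(G)=\sum_{i=1}^{k}\mu_{i}(G)$. Brouwer's conjecture for $G$ and $k$ is the inequality $S_{k}(G)\leq m+\binom{k+1}{2}$, where $m$ is the number of edges of $G$. *)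

theory Defs
  imports "Jordan_Normal_Form.Char_Poly"
begin

definition simple_graph :: "'a set \<Rightarrow> 'a set set \<Rightarrow> bool" where
  "simple_graph V E \<longleftrightarrow> finite V \<and> (\<forall>e\<in>E. e \<subseteq> V \<and> card e = 2)"

definition vertex_degree :: "'a set set \<Rightarrow> 'a \<Rightarrow> nat" where
  "vertex_degree E v = card {e \<in> E. v \<in> e}"

text \<open>
  The matrices depend on an enumeration \<open>vs\<close> of the vertex set, which assigns the vertex
  \<open>vs ! i\<close> to the row and column with index \<open>i\<close>. In a simple graph the diagonal of the
  adjacency matrix vanishes, since \<open>{v, v}\<close> has one element and is therefore not an edge.
\<close>

definition degree_matrix :: "'a list \<Rightarrow> 'a set set \<Rightarrow> real mat" where
  "degree_matrix vs E = mat (length vs) (length vs)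
     (\<lambda>(i, j). if i = j then real (vertex_degree E (vs ! i)) else 0)"

definition adjacency_matrix :: "'a list \<Rightarrow> 'a set set \<Rightarrow> real mat" where
  "adjacency_matrix vs E = mat (length vs) (length vs)
     (\<lambda>(i, j). if {vs ! i, vs ! j} \<in> E then 1 else 0)"

definition laplacian :: "'a list \<Rightarrow> 'a set set \<Rightarrow> real mat" where
  "laplacian vs E = degree_matrix vs E - adjacency_matrix vs E"

text \<open>
  The list is decreasing and contains each eigenvalue with its algebraic multiplicity. Only real
  roots are counted, but none are lost, see \<open>length_laplacian_eigenvalues\<close> below.
\<close>

definition laplacian_eigenvalues :: "'a list \<Rightarrow> 'a set set \<Rightarrow> real list" where
  "laplacian_eigenvalues vs E =
     rev (sorted_list_of_multiset (proots (char_poly (laplacian vs E))))"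

text \<open>\<open>laplacian_mu vs E i\<close> is the \<open>i\<close>-th largest eigenvalue, counted from \<open>1\<close>.\<close>

definition laplacian_mu :: "'a list \<Rightarrow> 'a set set \<Rightarrow> nat \<Rightarrow> real" where
  "laplacian_mu vs E i = laplacian_eigenvalues vs E ! (i - 1)"

definition laplacian_S :: "'a list \<Rightarrow> 'a set set \<Rightarrow> nat \<Rightarrow> real" where
  "laplacian_S vs E k = (\<Sum>i=1..k. laplacian_mu vs E i)"

lemma laplacian_carrier [simp]: "laplacian vs E \<in> carrier_mat (length vs) (length vs)"
  by (auto simp: laplacian_def degree_matrix_def adjacency_matrix_def)

lemma laplacian_sym:
  "i < length vs \<Longrightarrow> j < length vs \<Longrightarrow> laplacian vs E $$ (i, j) = laplacian vs E $$ (j, i)"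
  by (simp add: laplacian_def degree_matrix_def adjacency_matrix_def insert_commute)

lemma real_symmetric_eigenvalue_real:
  fixes A :: "real mat"
  assumes A: "A \<in> carrier_mat n n"
    and sym: "\<And>i j. i < n \<Longrightarrow> j < n \<Longrightarrow> A $$ (i, j) = A $$ (j, i)"
    and ev: "eigenvalue (map_mat complex_of_real A) a"
  shows "a \<in> \<real>"
proof -
  obtain v where v: "v \<in> carrier_vec n" "v \<noteq> 0\<^sub>v n"
    and Av: "map_mat complex_of_real A *\<^sub>v v = a \<cdot>\<^sub>v v"
    using ev A unfolding eigenvalue_def eigenvector_def by auto
  have row: "(\<Sum>j<n. complex_of_real (A $$ (i, j)) * v $ j) = a * v $ i" if "i < n" for i
  proof -
    have "(map_mat complex_of_real A *\<^sub>v v) $ i = (a \<cdot>\<^sub>v v) $ i" by (simp add: Av)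
    then show ?thesis using that A v
      by (simp add: scalar_prod_def lessThan_atLeast0)
  qed
  define s where "s = (\<Sum>i<n. \<Sum>j<n. cnj (v $ i) * complex_of_real (A $$ (i, j)) * v $ j)"
  define N where "N = (\<Sum>i<n. (cmod (v $ i))\<^sup>2)"
  have "s = (\<Sum>i<n. cnj (v $ i) * (a * v $ i))"
    unfolding s_def by (intro sum.cong refl) (simp add: row[symmetric] sum_distrib_left mult.assoc)
  also have "\<dots> = a * complex_of_real N"
    unfolding N_def of_real_sum sum_distrib_left
    by (intro sum.cong refl) (simp add: complex_norm_square mult_ac del: of_real_power)
  finally have s: "s = a * complex_of_real N" .
  have "cnj s = (\<Sum>i<n. \<Sum>j<n. v $ i * complex_of_real (A $$ (i, j)) * cnj (v $ j))"
    by (simp add: s_def)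
  also have "\<dots> = (\<Sum>j<n. \<Sum>i<n. v $ i * complex_of_real (A $$ (i, j)) * cnj (v $ j))"
    by (rule sum.swap)
  also have "\<dots> = s"
    unfolding s_def by (intro sum.cong refl) (use sym in \<open>simp add: mult_ac\<close>)
  finally have "s \<in> \<real>" by (simp add: Reals_cnj_iff)
  obtain i where i: "i < n" "v $ i \<noteq> 0" using v by (metis carrier_vecD eq_vecI index_zero_vec)
  have "N \<noteq> 0"
    using i by (auto simp: N_def sum_nonneg_eq_0_iff)
  then have "a = s / complex_of_real N" by (simp add: s)
  then show ?thesis using \<open>s \<in> \<real>\<close> by (simp add: Reals_divide)
qed

lemma real_symmetric_char_poly_splits:
  fixes A :: "real mat"
  assumes A: "A \<in> carrier_mat n n"
    and sym: "\<And>i j. i < n \<Longrightarrow> j < n \<Longrightarrow> A $$ (i, j) = A $$ (j, i)"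
  shows "\<exists>as. char_poly A = (\<Prod>a\<leftarrow>as. [:- a, 1:]) \<and> length as = n"
proof -
  interpret c: map_poly_inj_comm_ring_hom complex_of_real ..
  let ?C = "map_mat complex_of_real A"
  have C: "?C \<in> carrier_mat n n" using A by simp
  obtain as where as: "char_poly ?C = (\<Prod>a\<leftarrow>as. [:- a, 1:])" "length as = n"
    using char_poly_factorized[OF C] by blast
  have re: "complex_of_real (Re a) = a" if "a \<in> set as" for a
  proof -
    have "poly (char_poly ?C) a = 0"
      using that by (auto simp: as poly_prod_list prod_list_zero_iff)
    then have "eigenvalue ?C a" by (simp add: eigenvalue_root_char_poly[OF C])
    then show ?thesis
      using real_symmetric_eigenvalue_real[OF A sym] by simp
  qed
  have "map_poly complex_of_real (char_poly A) = char_poly ?C"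
    by (rule of_real_hom.char_poly_hom[OF A, symmetric])
  also have "\<dots> = map_poly complex_of_real (\<Prod>a\<leftarrow>map Re as. [:- a, 1:])"
    unfolding as c.hom_prod_list map_map
    by (rule arg_cong[of _ _ prod_list], rule map_cong) (use re in \<open>auto simp: o_def\<close>)
  finally have "char_poly A = (\<Prod>a\<leftarrow>map Re as. [:- a, 1:])" by simp
  then show ?thesis using as(2) by (metis length_map)
qed

lemma length_laplacian_eigenvalues: "length (laplacian_eigenvalues vs E) = length vs"
proof -
  obtain as where as: "char_poly (laplacian vs E) = (\<Prod>a\<leftarrow>as. [:- a, 1:])"
    "length as = length vs"
    using real_symmetric_char_poly_splits[OF laplacian_carrier laplacian_sym] by blast
  have "proots (\<Prod>a\<leftarrow>as. [:- a, 1:]) = mset as" for as :: "real list"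
  proof (induction as)
    case (Cons a as)
    have "(\<Prod>a\<leftarrow>as. [:- a, 1:]) \<noteq> (0 :: real poly)"
      by (auto simp: prod_list_zero_iff)
    then show ?case
      using Cons by (simp add: proots_mult del: mult_pCons_left)
  qed simp
  then have "mset (laplacian_eigenvalues vs E) = mset as"
    by (simp add: laplacian_eigenvalues_def as)
  then show ?thesis using as(2) by (metis size_mset)
qed

end

(* As the Laplacian is positive semidefinite, S_k is at most its trace 2m. By Cauchy-Schwarz, S_k^2 is
   at most k times the trace of the squared Laplacian, sum_v d(v)^2 + 2m, which is at most 2mn. If
   m <= k(k+1)/2, the first bound suffices. Otherwise m + k(k+1)/2 > k(k+1) >= k^2, and the lower
   bound on k gives 2mn <= k^3, so the second bound yields S_k^2 <= k^4. *)
theory Submission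
  imports Defs "Jordan_Normal_Form.Schur_Decomposition" "HOL-Analysis.Convex"
begin

section \<open>Traces and eigenvalues\<close>

definition mat_trace :: "'a :: comm_monoid_add mat \<Rightarrow> 'a" where
  "mat_trace A = (\<Sum>i<dim_row A. A $$ (i, i))"

lemma mat_trace_mult:
  fixes A B :: "'a :: semiring_0 mat"
  assumes "A \<in> carrier_mat n m" "B \<in> carrier_mat m n"
  shows "mat_trace (A * B) = (\<Sum>i<n. \<Sum>j<m. A $$ (i, j) * B $$ (j, i))"
  using assms by (auto simp: mat_trace_def scalar_prod_def lessThan_atLeast0 intro!: sum.cong)

lemma mat_trace_mult_commute:
  fixes A B :: "'a :: comm_semiring_0 mat"
  assumes "A \<in> carrier_mat n m" "B \<in> carrier_mat m n"
  shows "mat_trace (A * B) = mat_trace (B * A)"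
  unfolding mat_trace_mult[OF assms] mat_trace_mult[OF assms(2,1)]
  by (subst sum.swap) (simp add: mult.commute)

text \<open>Writing \<open>A\<close> as \<open>P * B * Q\<close>, cyclicity of the trace moves
  \<open>P\<close> to the end, where it cancels against \<open>Q\<close>.\<close>

lemma mat_trace_similar:
  fixes A B :: "'a :: comm_semiring_1 mat"
  assumes "similar_mat A B"
  shows "mat_trace A = mat_trace B"
proof -
  obtain P Q where sim: "similar_mat_wit A B P Q" using assms by (auto simp: similar_mat_def)
  note w = similar_mat_witD[OF refl sim]
  have "mat_trace A = mat_trace (P * (B * Q))"
    using w by (metis assoc_mult_mat)
  also have "\<dots> = mat_trace ((B * Q) * P)"
    by (rule mat_trace_mult_commute[OF w(6) mult_carrier_mat[OF w(5,7)]])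
  also have "(B * Q) * P = B"
    using assoc_mult_mat[OF w(5,7,6)] w(2) right_mult_one_mat[OF w(5)] by simp
  finally show ?thesis .
qed

lemma mat_trace_diag: "mat_trace A = sum_list (diag_mat A)"
  by (simp add: mat_trace_def diag_mat_def sum_list_sum_nth lessThan_atLeast0)

text \<open>In the sum for the diagonal entry, \<open>A\<close> vanishes at the indices
  \<open>j < i\<close> and \<open>B\<close> at the indices \<open>j > i\<close>, so only
  \<open>j = i\<close> survives.\<close>

lemma upper_triangular_mult_diag:
  fixes A B :: "'a :: semiring_0 mat"
  assumes A: "A \<in> carrier_mat n n" "upper_triangular A"
    and B: "B \<in> carrier_mat n n" "upper_triangular B"
    and i: "i < n"
  shows "(A * B) $$ (i, i) = A $$ (i, i) * B $$ (i, i)"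
proof -
  have "(A * B) $$ (i, i) = (\<Sum>j<n. A $$ (i, j) * B $$ (j, i))"
    using A B i by (auto simp: scalar_prod_def lessThan_atLeast0 intro!: sum.cong)
  also have "\<dots> = (\<Sum>j\<in>{i}. A $$ (i, j) * B $$ (j, i))"
  proof (rule sum.mono_neutral_right)
    show "\<forall>j\<in>{..<n} - {i}. A $$ (i, j) * B $$ (j, i) = 0"
    proof
      fix j assume "j \<in> {..<n} - {i}"
      then have "j < n" "j < i \<or> i < j" by auto
      then show "A $$ (i, j) * B $$ (j, i) = 0"
        using A B i by (auto simp: upper_triangular_def)
    qed
  qed (use i in auto)
  finally show ?thesis by simp
qed

text \<open>Schur decomposition makes \<open>A\<close> similar to an upper triangular matrix with
  diagonal \<open>es\<close>. Squaring respects the similarity and squares the diagonal, so both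
  traces can be read off the triangular side.\<close>

lemma eigenvalue_traces:
  fixes A :: "'a :: conjugatable_ordered_field mat"
  assumes A: "A \<in> carrier_mat n n" and es: "char_poly A = (\<Prod>e\<leftarrow>es. [:- e, 1:])"
  shows "sum_list es = mat_trace A" "(\<Sum>e\<leftarrow>es. e\<^sup>2) = mat_trace (A * A)"
proof -
  obtain B P Q where BPQ: "schur_decomposition A es = (B, P, Q)" by (metis prod_cases3)
  have sim: "similar_mat_wit A B P Q" and ut: "upper_triangular B" and d: "diag_mat B = es"
    using schur_decomposition[OF A es BPQ] by auto
  note w = similar_mat_witD2[OF A sim]
  have AB: "similar_mat A B" using sim by (auto simp: similar_mat_def)
  show "sum_list es = mat_trace A"
    using mat_trace_similar[OF AB] mat_trace_diag[of B] d by simp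
  have "similar_mat_wit (A ^\<^sub>m 2) (B ^\<^sub>m 2) P Q"
    by (rule similar_mat_wit_pow[OF sim])
  then have "similar_mat (A * A) (B * B)"
    using A w(5) by (auto simp: similar_mat_def numeral_2_eq_2)
  then have "mat_trace (A * A) = mat_trace (B * B)" by (rule mat_trace_similar)
  also have "\<dots> = (\<Sum>i<n. (B $$ (i, i))\<^sup>2)"
    using w(5) ut by (simp add: mat_trace_def upper_triangular_mult_diag power2_eq_square
        del: index_mult_mat(1))
  also have "\<dots> = (\<Sum>e\<leftarrow>es. e\<^sup>2)"
    using w(5) unfolding d[symmetric]
    by (simp add: diag_mat_def sum_list_sum_nth lessThan_atLeast0)
  finally show "(\<Sum>e\<leftarrow>es. e\<^sup>2) = mat_trace (A * A)" by simp
qed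

lemma proots_prod_linear: "proots (\<Prod>a\<leftarrow>as. [:- a, 1:]) = mset (as :: 'a :: idom list)"
proof (induction as)
  case (Cons a as)
  have "(\<Prod>a\<leftarrow>as. [:- a, 1:]) \<noteq> 0" by (auto simp: prod_list_zero_iff)
  then show ?case using Cons by (simp add: proots_mult del: mult_pCons_left)
qed simp

section \<open>The Laplacian\<close>

lemma dim_laplacian [simp]:
  "dim_row (laplacian vs E) = length vs" "dim_col (laplacian vs E) = length vs"
  using laplacian_carrier[of vs E] by (simp_all only: carrier_matD)

text \<open>Symmetry makes the polynomial split over the reals, so its real roots are all of its
  roots. The product depends only on their multiset, which allows the sorted list to replace an
  arbitrary list of roots.\<close>

lemma char_poly_laplacian:
  "char_poly (laplacian vs E) = (\<Prod>a\<leftarrow>laplacian_eigenvalues vs E. [:- a, 1:])"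
proof -
  obtain as where as: "char_poly (laplacian vs E) = (\<Prod>a\<leftarrow>as. [:- a, 1:])"
    using real_symmetric_char_poly_splits[OF laplacian_carrier laplacian_sym] by blast
  have "mset (laplacian_eigenvalues vs E) = mset as"
    by (simp add: laplacian_eigenvalues_def as proots_prod_linear)
  then have "(\<Prod>a\<leftarrow>laplacian_eigenvalues vs E. [:- a, 1:]) = (\<Prod>a\<leftarrow>as. [:- a, 1:])"
    by (metis mset_map prod_mset_prod_list)
  then show ?thesis by (simp add: as)
qed

lemma laplacian_S_conv_sum:
  "laplacian_S vs E k = (\<Sum>i<k. laplacian_eigenvalues vs E ! i)"
  unfolding laplacian_S_def laplacian_mu_def
  by (rule sum.reindex_bij_witness[of _ Suc "\<lambda>i. i - 1"]) auto

text \<open>Double counting of incidences: every edge contains exactly two vertices of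
  \<open>V\<close>.\<close>

lemma sum_degrees:
  assumes "simple_graph V E"
  shows "(\<Sum>v\<in>V. vertex_degree E v) = 2 * card E"
proof -
  have V: "finite V" and e: "\<forall>e\<in>E. e \<subseteq> V \<and> card e = 2"
    using assms by (auto simp: simple_graph_def)
  have "E \<subseteq> Pow V" using e by blast
  then have "finite E" using V by (meson finite_Pow_iff finite_subset)
  moreover have "{v \<in> V. v \<in> e} = e" if "e \<in> E" for e using e that by blast
  ultimately show ?thesis
    unfolding vertex_degree_def using V e by (intro sum_multicount) auto
qed

section \<open>The Laplacian in index form: entries, traces and positive semidefiniteness\<close>

locale enumerated_graph =
  fixes V :: "'a set" and E :: "'a set set" and vs :: "'a list"
  assumes graph: "simple_graph V E" and dist: "distinct vs" and set_vs: "set vs = V"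
begin

abbreviation "n \<equiv> length vs"

definition adj :: "nat \<Rightarrow> nat \<Rightarrow> real" where
  "adj i j = (if {vs ! i, vs ! j} \<in> E then 1 else 0)"

definition deg :: "nat \<Rightarrow> real" where
  "deg i = real (vertex_degree E (vs ! i))"

lemma adj_commute: "adj i j = adj j i"
  by (simp add: adj_def insert_commute)

lemma adj_diag: "adj i i = 0"
  using graph by (auto simp: adj_def simple_graph_def)

lemma laplacian_entry:
  "i < n \<Longrightarrow> j < n \<Longrightarrow> laplacian vs E $$ (i, j) = (if i = j then deg i else 0) - adj i j"
  by (simp add: laplacian_def degree_matrix_def adjacency_matrix_def adj_def deg_def)

text \<open>Joining \<open>vs ! i\<close> to its neighbours matches their positions with the
  incident edges. Distinctness of \<open>vs\<close> makes this injective.\<close>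

lemma sum_adj:
  assumes i: "i < n"
  shows "(\<Sum>j<n. adj i j) = deg i"
proof -
  have "bij_betw (\<lambda>j. {vs ! i, vs ! j}) {j. j < n \<and> {vs ! i, vs ! j} \<in> E} {e \<in> E. vs ! i \<in> e}"
  proof (rule bij_betw_imageI)
    show "inj_on (\<lambda>j. {vs ! i, vs ! j}) {j. j < n \<and> {vs ! i, vs ! j} \<in> E}"
      using dist by (auto intro!: inj_onI simp: doubleton_eq_iff nth_eq_iff_index_eq)
    show "(\<lambda>j. {vs ! i, vs ! j}) ` {j. j < n \<and> {vs ! i, vs ! j} \<in> E} = {e \<in> E. vs ! i \<in> e}"
    proof (intro equalityI subsetI)
      fix e assume e: "e \<in> {e \<in> E. vs ! i \<in> e}"
      then have "card e = 2" "e \<subseteq> set vs"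
        using graph set_vs by (auto simp: simple_graph_def)
      \<comment> \<open>The other endpoint \<open>w\<close> occurs in \<open>vs\<close>, and its
        position is the preimage of \<open>e\<close>.\<close>
      then obtain w where "e = {vs ! i, w}" "w \<in> set vs"
        using e by (auto simp: card_2_iff)
      then show "e \<in> (\<lambda>j. {vs ! i, vs ! j}) ` {j. j < n \<and> {vs ! i, vs ! j} \<in> E}"
        using e by (auto simp: in_set_conv_nth)
    qed auto
  qed
  then have "card {j. j < n \<and> {vs ! i, vs ! j} \<in> E} = vertex_degree E (vs ! i)"
    unfolding vertex_degree_def by (rule bij_betw_same_card)
  moreover have "(\<Sum>j<n. adj i j) = (\<Sum>j\<in>{j. j < n \<and> {vs ! i, vs ! j} \<in> E}. 1)"
    unfolding adj_def by (subst sum.inter_filter[symmetric]) auto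
  ultimately show ?thesis by (simp add: deg_def)
qed

lemma sum_deg: "(\<Sum>i<n. deg i) = 2 * real (card E)"
proof -
  have "(\<Sum>i<n. vertex_degree E (vs ! i)) = (\<Sum>v\<in>V. vertex_degree E v)"
    using bij_betw_nth[OF dist refl set_vs[symmetric]] by (rule sum.reindex_bij_betw)
  then show ?thesis
    unfolding deg_def by (simp add: sum_degrees[OF graph] flip: of_nat_sum)
qed

text \<open>A row of the adjacency matrix has a zero on the diagonal and n - 1 further entries, each
  at most 1.\<close>

lemma deg_plus_one_le:
  assumes i: "i < n"
  shows "deg i + 1 \<le> real n"
proof -
  have "deg i = (\<Sum>j\<in>{..<n} - {i}. adj i j)"
    using i by (simp add: sum_adj[symmetric] sum.remove[of _ i] adj_diag)
  also have "\<dots> \<le> (\<Sum>j\<in>{..<n} - {i}. 1)"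
    by (rule sum_mono) (simp add: adj_def)
  finally show ?thesis using i by (simp add: of_nat_diff)
qed

lemma trace_laplacian: "mat_trace (laplacian vs E) = 2 * real (card E)"
proof -
  have "mat_trace (laplacian vs E) = (\<Sum>i<n. laplacian vs E $$ (i, i))"
    by (simp add: mat_trace_def)
  then show ?thesis by (simp add: laplacian_entry adj_diag sum_deg)
qed

lemma trace_laplacian_square_le:
  "mat_trace (laplacian vs E * laplacian vs E) \<le> 2 * real (card E) * real n"
proof -
  have "mat_trace (laplacian vs E * laplacian vs E) =
      (\<Sum>i<n. \<Sum>j<n. laplacian vs E $$ (i, j) * laplacian vs E $$ (j, i))"
    by (rule mat_trace_mult) simp_all
  \<comment> \<open>Off the diagonal, the product of the two mirrored entries is the square of
    \<open>adj i j\<close>, which equals \<open>adj i j\<close> because its value is 0 or 1.\<close>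
  also have "\<dots> = (\<Sum>i<n. \<Sum>j<n. (if i = j then (deg i)\<^sup>2 else 0) + adj i j)"
    by (intro sum.cong refl)
      (auto simp: laplacian_entry adj_diag power2_eq_square, auto simp: adj_def insert_commute)
  also have "\<dots> = (\<Sum>i<n. deg i * (deg i + 1))"
    by (intro sum.cong refl) (simp add: sum.distrib sum_adj power2_eq_square algebra_simps)
  also have "\<dots> \<le> (\<Sum>i<n. deg i * real n)"
    by (intro sum_mono mult_left_mono deg_plus_one_le) (auto simp: deg_def)
  also have "\<dots> = 2 * real (card E) * real n"
    by (simp add: sum_deg flip: sum_distrib_right)
  finally show ?thesis .
qed

text \<open>For an eigenvector \<open>x\<close>, the eigenvalue times the squared norm of
  \<open>x\<close> is the quadratic form of the Laplacian, which is half the sum of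
  \<open>adj i j\<close> times the squared differences of coordinates.\<close>

lemma laplacian_eigenvalue_nonneg:
  assumes "a \<in> set (laplacian_eigenvalues vs E)"
  shows "a \<ge> 0"
proof -
  have "poly (char_poly (laplacian vs E)) a = 0"
    using assms by (auto simp: char_poly_laplacian poly_prod_list prod_list_zero_iff)
  then have "eigenvalue (laplacian vs E) a"
    by (simp add: eigenvalue_root_char_poly[OF laplacian_carrier])
  then obtain x where x: "x \<in> carrier_vec n" "x \<noteq> 0\<^sub>v n"
    and Lx: "laplacian vs E *\<^sub>v x = a \<cdot>\<^sub>v x"
    using laplacian_carrier[of vs E] unfolding eigenvalue_def eigenvector_def by auto
  \<comment> \<open>Writing the degree as a row sum of \<open>adj\<close> turns each coordinate of
    the Laplacian image into a sum of differences.\<close>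
  have row: "a * x $ i = (\<Sum>j<n. adj i j * (x $ i - x $ j))" if i: "i < n" for i
  proof -
    have "a * x $ i = (laplacian vs E *\<^sub>v x) $ i" using i x by (simp add: Lx)
    also have "\<dots> = (\<Sum>j<n. laplacian vs E $$ (i, j) * x $ j)"
      using i x by (auto simp: scalar_prod_def lessThan_atLeast0 intro!: sum.cong)
    also have "\<dots> = (\<Sum>j<n. (if i = j then deg i * x $ i else 0) - adj i j * x $ j)"
      using i by (intro sum.cong refl) (auto simp: laplacian_entry algebra_simps)
    also have "\<dots> = (\<Sum>j<n. adj i j) * x $ i - (\<Sum>j<n. adj i j * x $ j)"
      using i by (simp add: sum_subtractf sum_adj)
    finally show ?thesis
      by (simp add: sum_distrib_right right_diff_distrib sum_subtractf)
  qed
  have swap: "(\<Sum>i<n. \<Sum>j<n. adj i j * (x $ i)\<^sup>2) = (\<Sum>i<n. \<Sum>j<n. adj i j * (x $ j)\<^sup>2)"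
    by (subst sum.swap) (simp add: adj_commute)
  \<comment> \<open>The summand is antisymmetric in \<open>i\<close> and \<open>j\<close>, so the
    double sum vanishes. Each term of the quadratic form exceeds its counterpart here by half of
    \<open>adj i j\<close> times a squared difference.\<close>
  have "0 = (\<Sum>i<n. \<Sum>j<n. adj i j * (((x $ i)\<^sup>2 - (x $ j)\<^sup>2) / 2))"
    using swap by (simp add: algebra_simps diff_divide_distrib sum_subtractf flip: sum_divide_distrib)
  also have "\<dots> \<le> (\<Sum>i<n. \<Sum>j<n. adj i j * (x $ i * (x $ i - x $ j)))"
  proof (intro sum_mono mult_left_mono)
    fix i j
    have "0 \<le> (x $ i - x $ j)\<^sup>2" by simp
    then show "((x $ i)\<^sup>2 - (x $ j)\<^sup>2) / 2 \<le> x $ i * (x $ i - x $ j)"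
      by (simp add: power2_eq_square field_simps)
  qed (simp add: adj_def)
  also have "\<dots> = (\<Sum>i<n. x $ i * (a * x $ i))"
    by (intro sum.cong refl) (simp add: row sum_distrib_left mult_ac)
  also have "\<dots> = a * (\<Sum>i<n. (x $ i)\<^sup>2)"
    by (simp add: sum_distrib_left power2_eq_square mult_ac)
  finally have "0 \<le> a * (\<Sum>i<n. (x $ i)\<^sup>2)" .
  moreover obtain i where "i < n" "x $ i \<noteq> 0"
    using x by (metis carrier_vecD eq_vecI index_zero_vec)
  then have "0 < (\<Sum>i<n. (x $ i)\<^sup>2)" by (intro sum_pos2[of _ i]) auto
  ultimately show ?thesis by (simp add: zero_le_mult_iff)
qed

section \<open>Bounds on the partial eigenvalue sums\<close>

lemma laplacian_S_le:
  assumes k: "k \<le> n"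
  shows "laplacian_S vs E k \<le> 2 * real (card E)"
    and "(laplacian_S vs E k)\<^sup>2 \<le> 2 * real (card E) * real n * real k"
proof -
  let ?l = "laplacian_eigenvalues vs E"
  note traces = eigenvalue_traces[OF laplacian_carrier char_poly_laplacian]
  have nonneg: "?l ! i \<ge> 0" if "i < n" for i
    using that by (intro laplacian_eigenvalue_nonneg) (simp add: length_laplacian_eigenvalues)
  \<comment> \<open>Extending the sum to all eigenvalues adds only nonnegative terms and produces
    the trace.\<close>
  have "laplacian_S vs E k \<le> (\<Sum>i<n. ?l ! i)"
    unfolding laplacian_S_conv_sum using k nonneg by (intro sum_mono2) auto
  also have "\<dots> = 2 * real (card E)"
    using traces(1)[of vs E]
    by (simp add: trace_laplacian sum_list_sum_nth length_laplacian_eigenvalues lessThan_atLeast0)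
  finally show "laplacian_S vs E k \<le> 2 * real (card E)" .
  \<comment> \<open>Cauchy-Schwarz against the constant vector of length \<open>k\<close>; the sum
    of squares is then extended to the whole spectrum.\<close>
  have "(laplacian_S vs E k)\<^sup>2 \<le> (\<Sum>i<k. (?l ! i)\<^sup>2) * real k"
    unfolding laplacian_S_conv_sum
    using sum_squared_le_sum_of_squares[of "\<lambda>i. ?l ! i" "{..<k}"] by simp
  also have "\<dots> \<le> (\<Sum>i<n. (?l ! i)\<^sup>2) * real k"
    using k by (intro mult_right_mono sum_mono2) auto
  also have "(\<Sum>i<n. (?l ! i)\<^sup>2) = mat_trace (laplacian vs E * laplacian vs E)"
    using traces(2)[of vs E]
    by (simp add: sum_list_sum_nth length_laplacian_eigenvalues lessThan_atLeast0)
  also have "\<dots> * real k \<le> 2 * real (card E) * real n * real k"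
    by (intro mult_right_mono trace_laplacian_square_le) simp
  finally show "(laplacian_S vs E k)\<^sup>2 \<le> 2 * real (card E) * real n * real k" .
qed

lemma brouwer_inequality:
  assumes k: "k \<le> n" and bound: "2 * real (card E) * real n \<le> real k ^ 3"
  shows "laplacian_S vs E k \<le> real (card E) + real ((k + 1) choose 2)"
proof -
  \<comment> \<open>The doubled identity removes the integer division by 2 before passing to the
    reals.\<close>
  have "2 * ((k + 1) choose 2) = k * (k + 1)"
    by (simp add: choose_two)
  then have c: "real ((k + 1) choose 2) = real k * (real k + 1) / 2"
    by (metis (no_types, lifting) nonzero_mult_div_cancel_left of_nat_1 of_nat_add of_nat_mult
        of_nat_numeral zero_neq_numeral)
  show ?thesis
  proof (cases "real (card E) \<le> real ((k + 1) choose 2)")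
    case True
    then show ?thesis using laplacian_S_le(1)[OF k] by simp
  next
    case False
    have "(laplacian_S vs E k)\<^sup>2 \<le> real k ^ 3 * real k"
      using laplacian_S_le(2)[OF k] mult_right_mono[OF bound, of "real k"] by simp
    also have "\<dots> = (real k ^ 2)\<^sup>2" by (simp add: power_numeral_reduce)
    finally have "laplacian_S vs E k \<le> real k ^ 2" by (rule power2_le_imp_le) simp
    \<comment> \<open>Twice the binomial coefficient is \<open>k\<close> squared plus
      \<open>k\<close>. In this case one of the two copies can be replaced by the larger number of
      edges.\<close>
    also have "\<dots> \<le> 2 * real ((k + 1) choose 2)"
      unfolding c by (simp add: power2_eq_square algebra_simps)
    finally show ?thesis using False by simp
  qed
qed

end

theorem theorem5:
  fixes V :: "'a set" and E :: "'a set set" and vs :: "'a list" and n m k :: nat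
  assumes "simple_graph V E"
    and "distinct vs" and "set vs = V"
    and "n = card V" and "m = card E"
    and "n \<le> m"
    and "real m \<le> (sqrt 3 - 1) / 4 * (real n - 1) * real n"
    and "root 3 (8 * (real m)^2 / (real n - 1) + 4 * real m * real n + (real n)^2) \<le> real k"
    and "k \<le> n"
  shows "laplacian_S vs E k \<le> real m + real ((k + 1) choose 2)"
proof -
  interpret g: enumerated_graph V E vs using assms(1-3) by unfold_locales
  have n: "n = length vs" using assms(2-4) distinct_card by blast
  show ?thesis
  \<comment> \<open>For \<open>n = 0\<close> the denominator is -1, so the fraction cannot be
    treated as nonnegative by its signs; but then \<open>k = 0\<close> and the sum is empty.\<close>
  proof (cases "n = 0")
    case True
    then show ?thesis using assms(9) by (simp add: laplacian_S_def)
  next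
    case False
    define r where "r = 8 * (real m)^2 / (real n - 1) + 4 * real m * real n + (real n)^2"
    \<comment> \<open>This includes \<open>n = 1\<close>, where the denominator is 0 and the
      quotient is 0 by convention.\<close>
    have "0 \<le> 8 * (real m)^2 / (real n - 1)" using False by simp
    \<comment> \<open>All three summands of \<open>r\<close> are nonnegative, and the middle one,
      4mn, already dominates 2mn.\<close>
    then have r: "2 * real m * real n \<le> r" "0 \<le> r"
      by (simp_all add: r_def add_nonneg_nonneg)
    have "r = root 3 r ^ 3" using r(2) by simp
    also have "\<dots> \<le> real k ^ 3"
      using assms(8) r(2) by (intro power_mono) (simp_all add: r_def)
    finally have "2 * real (card E) * real (length vs) \<le> real k ^ 3"
      using r(1) n assms(5) by simp
    then show ?thesis
      using g.brouwer_inequality[of k] assms(5,9) n by simp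
  qed
qed

end
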